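(* Let $n\le 3$ and let $u$ be a solution of the one-phase free boundary problem $$\Delta u=0\ \text{ in }\ \Xi:=\{u>0\}\subset\mathbb{R}^n,\qquad |\nabla u|=1\ \text{ on }\ \partial\Xi,$$ with $|\nabla u|\le 1$, where $u$ is understood in the classical sense in $\overline{\Xi}$ and $\partial\Xi$ is globally smooth. Suppose that the positive phase $\Xi$ is contained in the half-space $\{x\in\mathbb{R}^n:x_n>0\}$. Then $u$ is one-dimensional, namely there is $h\ge 0$ such that $\Xi=\{x\in\mathbb{R}^n:x_n>h\}$ and $u$ is the one-dimensional function $u(x)=x_n-h$ for all $x\in\overline{\Xi}$.
   Context: Here $n\ge1$ is the dimension, $x=(x_1,\dots,x_n)\in\mathbb{R}^n$, and $\Xi$ (the positive phase) is the set where $u$ is positive, with free boundary $\partial\Xi$. Since $u$ is understood in the classical sense in $\overline{\Xi}$, the condition $|\nabla u|=1$ on $\partial\Xi$ concerns the gradient of $u$ taken from within $\overline{\Xi}$. *)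

theory Defs
  imports "HOL-Analysis.Analysis"
begin

definition partial_within :: "(real^'n) set \<Rightarrow> 'n \<Rightarrow> (real^'n \<Rightarrow> real) \<Rightarrow> real^'n \<Rightarrow> real" where
  "partial_within S i f x = frechet_derivative f (at x within S) (axis i 1)"

abbreviation partial :: "'n \<Rightarrow> (real^'n \<Rightarrow> real) \<Rightarrow> real^'n \<Rightarrow> real" where
  "partial i f \<equiv> partial_within UNIV i f"

definition grad_within :: "(real^'n) set \<Rightarrow> (real^'n \<Rightarrow> real) \<Rightarrow> real^'n \<Rightarrow> real^'n" where
  "grad_within S f x = (\<chi> i. partial_within S i f x)"

abbreviation grad :: "(real^'n \<Rightarrow> real) \<Rightarrow> real^'n \<Rightarrow> real^'n" where
  "grad f \<equiv> grad_within UNIV f"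

text \<open>\<open>Ck_on\<close>, \<open>smooth_on\<close> and \<open>harmonic_on\<close> are meant for open \<open>S\<close>: their partial derivatives
  are taken in the whole space.\<close>

primrec Ck_on :: "nat \<Rightarrow> (real^'n) set \<Rightarrow> (real^'n \<Rightarrow> real) \<Rightarrow> bool" where
  "Ck_on 0 S f \<longleftrightarrow> continuous_on S f"
| "Ck_on (Suc k) S f \<longleftrightarrow> f differentiable_on S \<and> (\<forall>i. Ck_on k S (partial i f))"

definition smooth_on :: "(real^'n) set \<Rightarrow> (real^'n \<Rightarrow> real) \<Rightarrow> bool" where
  "smooth_on S f \<longleftrightarrow> (\<forall>k. Ck_on k S f)"

definition laplacian :: "(real^'n \<Rightarrow> real) \<Rightarrow> real^'n \<Rightarrow> real" where
  "laplacian f x = (\<Sum>i\<in>UNIV. partial i (partial i f) x)"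

definition harmonic_on :: "(real^'n) set \<Rightarrow> (real^'n \<Rightarrow> real) \<Rightarrow> bool" where
  "harmonic_on S f \<longleftrightarrow> Ck_on 2 S f \<and> (\<forall>x\<in>S. laplacian f x = 0)"

definition smooth_hypersurface :: "(real^'n) set \<Rightarrow> bool" where
  "smooth_hypersurface M \<longleftrightarrow>
     (\<forall>p\<in>M. \<exists>U \<phi>. open U \<and> p \<in> U \<and> smooth_on U \<phi> \<and> (\<forall>x\<in>U. grad \<phi> x \<noteq> 0) \<and>
        M \<inter> U = {x \<in> U. \<phi> x = 0})"

definition C1_closure :: "(real^'n) set \<Rightarrow> (real^'n \<Rightarrow> real) \<Rightarrow> bool" where
  "C1_closure S f \<longleftrightarrow>
     f differentiable_on closure S \<and> continuous_on (closure S) (grad_within (closure S) f)"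

definition positive_phase :: "(real^'n \<Rightarrow> real) \<Rightarrow> (real^'n) set" where
  "positive_phase u = {x. u x > 0}"

text \<open>Classical solutions: \<open>u\<close> is \<open>C\<^sup>2\<close> in the positive phase and \<open>C\<^sup>1\<close> up to the free boundary,
  with the gradient there taken from within the closure of the positive phase. The values of \<open>u\<close>
  off that closure play no role. Openness of the positive phase and continuity of \<open>u\<close> on its
  closure force \<open>u = 0\<close> on the free boundary.\<close>

definition one_phase_solution :: "(real^'n \<Rightarrow> real) \<Rightarrow> bool" where
  "one_phase_solution u \<longleftrightarrow>
     (let \<Xi> = positive_phase u in
        open \<Xi> \<and> C1_closure \<Xi> u \<and> harmonic_on \<Xi> u \<and>
        (\<forall>x\<in>frontier \<Xi>. norm (grad_within (closure \<Xi>) u x) = 1))"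

end

theory Submission
  imports Defs
begin

text \<open>
  Put \<open>w = x\<^sub>k - u\<close> and \<open>X = \<nabla>w = e\<^sub>k - \<nabla>u\<close> on the positive phase. The field \<open>X\<close> is divergence free,
  \<open>|\<nabla>u| \<le> 1\<close> gives \<open>|X|\<^sup>2 \<le> 2 X\<^sub>k\<close>, and \<open>|\<nabla>u| = 1\<close> on the free boundary makes \<open>X\<close> point out of the
  phase there, so \<open>\<integral> X \<bullet> \<nabla>\<zeta> \<ge> 0\<close> for every test function \<open>\<zeta> \<ge> 0\<close>. For \<open>\<zeta> = g\<^sub>+\<^sup>2 (t - x\<^sub>k)\<^sub>+\<^sup>2\<close> with
  a logarithmic cutoff \<open>g\<close>, Young's inequality turns this into
  \<open>\<integral> g\<^sub>+\<^sup>2 (t - x\<^sub>k)\<^sub>+ |X|\<^sup>2 \<le> 4 t\<^sup>3 \<integral> |\<nabla>g|\<^sup>2\<close>, where the last integral runs over a part of the slab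
  \<open>0 < x\<^sub>k < t\<close>. In dimension at most 3 slabs are parabolic, so the right-hand side can be made
  arbitrarily small while \<open>g \<rightarrow> 1\<close> locally. Hence \<open>X = 0\<close>, i.e. \<open>\<nabla>u = e\<^sub>k\<close> on the phase.
\<close>

section \<open>Integrals of directional derivatives\<close>

text \<open>Translation invariance of Lebesgue measure plus dominated convergence. Only derivatives
  along the single direction \<open>e\<close> enter, so a product that vanishes off a compact subset
  of the phase can be integrated over the whole space, without regularity of \<open>u\<close>
  elsewhere.\<close>

lemma integral_directional_derivative_eq_0:
  fixes f f' :: "'a::euclidean_space \<Rightarrow> real"
  assumes K: "compact K" "continuous_on K f" "continuous_on K f'"
    and off: "\<And>x. x \<notin> K \<Longrightarrow> f x = 0" "\<And>x. x \<notin> K \<Longrightarrow> f' x = 0"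
    and deriv: "\<And>x. x \<in> K \<Longrightarrow> ((\<lambda>s. f (x + s *\<^sub>R e)) has_real_derivative f' x) (at 0)"
  shows "integrable lborel f'" "integral\<^sup>L lborel f' = 0"
proof -
  have intg: "integrable lborel g" if "continuous_on K g" "\<And>x. x \<notin> K \<Longrightarrow> g x = 0" for g :: "'a \<Rightarrow> real"
  proof -
    have "integrable lborel (\<lambda>x. indicator K x *\<^sub>R g x)"
      using borel_integrable_compact[OF K(1) that(1)] .
    moreover have "(\<lambda>x. indicator K x *\<^sub>R g x) = g"
      using that(2) by (auto simp: indicator_def fun_eq_iff)
    ultimately show ?thesis by simp
  qed
  have intf: "integrable lborel f" and "integrable lborel f'"
    using intg K off by auto
  then show "integrable lborel f'" by simp
  have d0: "((\<lambda>s. f (x + s *\<^sub>R e)) has_real_derivative f' x) (at 0)" for x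
  proof (cases "x \<in> K")
    case False
    \<comment> \<open>Off \<open>K\<close> the function vanishes in a whole neighbourhood, so the
      derivative there is 0.\<close>
    have "open (- K)" using compact_imp_closed[OF K(1)] by (rule open_Compl)
    then have "open ((\<lambda>s::real. x + s *\<^sub>R e) -` (- K))"
      by (rule open_vimage) (intro continuous_intros)
    then have "\<forall>\<^sub>F s in nhds 0. s \<in> (\<lambda>s::real. x + s *\<^sub>R e) -` (- K)"
      using False by (intro eventually_nhds_in_open) auto
    then have "\<forall>\<^sub>F s in nhds (0::real). f (x + s *\<^sub>R e) = 0"
      by eventually_elim (auto simp: off)
    then show ?thesis
      using DERIV_cong_ev[of 0 0 "\<lambda>s. f (x + s *\<^sub>R e)" "\<lambda>_. 0" "f' x" "f' x"] False off by auto
  qed (use deriv in auto)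
  have d: "((\<lambda>s. f (x + s *\<^sub>R e)) has_real_derivative f' (x + s *\<^sub>R e)) (at s)" for x s
    using d0[of "x + s *\<^sub>R e"] DERIV_at_within_shift[of "\<lambda>s. f (x + s *\<^sub>R e)" "f' (x + s *\<^sub>R e)" s 0 UNIV]
    by (simp add: scaleR_add_left ac_simps)
  obtain R where R: "\<And>x. x \<in> K \<Longrightarrow> norm x \<le> R"
    using compact_imp_bounded[OF K(1)] bounded_iff by blast
  obtain B0 where B0: "\<And>x. x \<in> K \<Longrightarrow> norm (f' x) \<le> B0"
    using compact_imp_bounded[OF compact_continuous_image[OF K(3) K(1)]] unfolding bounded_iff by blast
  define B where "B = max B0 0"
  have B: "\<bar>f' x\<bar> \<le> B" for x
    using B0[of x] off(2)[of x] by (cases "x \<in> K") (auto simp: B_def)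
  define s where "s j = inverse (real (Suc j))" for j
  have s: "0 < s j" "s j \<le> 1" for j by (auto simp: s_def field_simps)
  have s0: "s \<longlonglongrightarrow> 0" unfolding s_def by (rule LIMSEQ_inverse_real_of_nat)
  define q where "q j x = (f (x + s j *\<^sub>R e) - f x) / s j" for j x
  have shift: "integrable lborel (\<lambda>x. f (x + c))" "integral\<^sup>L lborel (\<lambda>x. f (x + c)) = integral\<^sup>L lborel f" for c
  proof -
    have m: "f \<in> borel_measurable borel" using intf by auto
    have "integral\<^sup>L (distr lborel borel ((+) c)) f = integral\<^sup>L lborel (\<lambda>x. f (c + x))"
      by (rule integral_distr) (use m in auto)
    then show "integral\<^sup>L lborel (\<lambda>x. f (x + c)) = integral\<^sup>L lborel f"
      by (simp only: lborel_distr_plus add.commute[of c])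
    have "integrable (distr lborel borel ((+) c)) f = integrable lborel (\<lambda>x. f (c + x))"
      by (rule integrable_distr_eq) (use m in auto)
    then show "integrable lborel (\<lambda>x. f (x + c))"
      using intf by (simp only: lborel_distr_plus add.commute[of c])
  qed
  have intq: "integral\<^sup>L lborel (q j) = 0" "q j \<in> borel_measurable lborel" for j
    unfolding q_def using shift[of "s j *\<^sub>R e"] intf by auto
  \<comment> \<open>the difference quotients \<open>q j\<close> have integral 0 by translation invariance\<close>
  have "(\<lambda>j. integral\<^sup>L lborel (q j)) \<longlonglongrightarrow> integral\<^sup>L lborel f'"
  proof (rule integral_dominated_convergence[where w = "\<lambda>x. indicator (cball 0 (R + norm e)) x *\<^sub>R B"])
    show "f' \<in> borel_measurable lborel" using \<open>integrable lborel f'\<close> by auto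
    show "integrable lborel (\<lambda>x. indicator (cball 0 (R + norm e)) x *\<^sub>R B)"
      by (intro borel_integrable_compact) auto
    show "AE x in lborel. (\<lambda>j. q j x) \<longlonglongrightarrow> f' x"
    proof (rule AE_I2)
      fix x
      have "((\<lambda>h. (f (x + h *\<^sub>R e) - f x) / h) \<longlongrightarrow> f' x) (at 0)"
        using d0[of x] by (simp add: has_field_derivative_iff)
      moreover have "filterlim s (at 0) sequentially"
        using s0 s(1) by (auto simp: filterlim_at less_imp_neq[symmetric] intro!: always_eventually)
      ultimately show "(\<lambda>j. q j x) \<longlonglongrightarrow> f' x"
        unfolding q_def by (rule filterlim_compose)
    qed
    fix j
    show "q j \<in> borel_measurable lborel" by (rule intq)
    \<comment> \<open>Inside the ball the mean value theorem turns \<open>q j x\<close> into a value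
      of \<open>f'\<close>, bounded by \<open>B\<close>. Outside it both \<open>x\<close> and
      \<open>x + s j *\<^sub>R e\<close> miss \<open>K\<close>, because
      \<open>s j \<le> 1\<close>.\<close>
    show "AE x in lborel. norm (q j x) \<le> indicator (cball 0 (R + norm e)) x *\<^sub>R B"
    proof (rule AE_I2)
      fix x
      show "norm (q j x) \<le> indicator (cball 0 (R + norm e)) x *\<^sub>R B"
      proof (cases "x \<in> cball 0 (R + norm e)")
        case True
        obtain z where "f (x + s j *\<^sub>R e) - f (x + 0 *\<^sub>R e) = (s j - 0) * f' (x + z *\<^sub>R e)"
          using MVT2[of 0 "s j" "\<lambda>s. f (x + s *\<^sub>R e)" "\<lambda>s. f' (x + s *\<^sub>R e)"] d s(1) by blast
        then have "q j x = f' (x + z *\<^sub>R e)" using s(1)[of j] by (simp add: q_def)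
        then show ?thesis using B True by simp
      next
        case False
        then have n: "norm x > R + norm e" by simp
        have "norm x \<le> norm (x + s j *\<^sub>R e) + norm (s j *\<^sub>R e)"
          using norm_triangle_ineq4[of "x + s j *\<^sub>R e" "s j *\<^sub>R e"] by simp
        moreover have "norm (s j *\<^sub>R e) \<le> norm e"
          using s[of j] by (simp add: mult_left_le_one_le)
        ultimately have "norm (x + s j *\<^sub>R e) > R" "norm x > R"
          using n norm_ge_zero[of e] by linarith+
        then have "x + s j *\<^sub>R e \<notin> K" "x \<notin> K" using R by force+
        then show ?thesis using off False by (simp add: q_def)
      qed
    qed
  qed
  then have "(\<lambda>_. 0) \<longlonglongrightarrow> integral\<^sup>L lborel f'" by (simp only: intq)
  then show "integral\<^sup>L lborel f' = 0" by (rule LIMSEQ_unique[OF _ tendsto_const])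
qed

section \<open>Continuously differentiable cutoffs of one variable\<close>

text \<open>The square makes the positive part C^1 across 0, which is all the regularity that test
  functions need here.\<close>

definition pos_square :: "real \<Rightarrow> real" where
  "pos_square y = (max 0 y)\<^sup>2"

lemma DERIV_pos_square: "(pos_square has_real_derivative 2 * max 0 y) (at y)"
proof (cases y "0::real" rule: linorder_cases)
  case less
  have "\<forall>\<^sub>F z in nhds y. pos_square z = 0"
    using eventually_nhds_in_open[of "{..<0}" y] less
    by (auto elim!: eventually_mono simp: pos_square_def)
  then show ?thesis
    using DERIV_cong_ev[of y y pos_square "\<lambda>_. 0" 0 0] less by simp
next
  case equal
  have "((\<lambda>h. max 0 h) \<longlongrightarrow> max 0 (0::real)) (at 0)"
    by (intro tendsto_intros)
  moreover have "\<forall>\<^sub>F h in at (0::real). max 0 h = (pos_square (0 + h) - pos_square 0) / h"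
    by (auto simp: pos_square_def eventually_at power2_eq_square max_def intro!: exI[of _ 1])
  ultimately have "((\<lambda>h. (pos_square (0 + h) - pos_square 0) / h) \<longlongrightarrow> 0) (at 0)"
    by (subst tendsto_cong[symmetric]) auto
  then show ?thesis using equal by (simp add: has_field_derivative_iff)
next
  case greater
  have "\<forall>\<^sub>F z in nhds y. pos_square z = z\<^sup>2"
    using eventually_nhds_in_open[of "{0<..}" y] greater
    by (auto elim!: eventually_mono simp: pos_square_def)
  moreover have "((\<lambda>z. z\<^sup>2) has_real_derivative 2 * y) (at y)"
    by (auto intro!: derivative_eq_intros)
  ultimately show ?thesis
    using DERIV_cong_ev[of y y pos_square "\<lambda>z. z\<^sup>2" "2 * y" "2 * y"] greater by simp
qed

text \<open>Half a second difference of \<open>pos_square\<close> works: its derivative is the tent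
  on \<open>[d, 3 * d]\<close> with peak \<open>1 / d\<close> at \<open>2 * d\<close>, which has
  area 1.\<close>

lemma ex_C1_step:
  fixes d :: real
  assumes "d > 0"
  obtains c c' :: "real \<Rightarrow> real" where
    "\<And>s. (c has_real_derivative c' s) (at s)" "continuous_on UNIV c'"
    "\<And>s. 0 \<le> c' s" "\<And>s. 0 \<le> c s" "\<And>s. c s \<le> 1"
    "\<And>s. s \<le> d \<Longrightarrow> c s = 0" "\<And>s. s \<le> d \<Longrightarrow> c' s = 0"
    "\<And>s. s \<ge> 3 * d \<Longrightarrow> c s = 1" "\<And>s. s \<ge> 3 * d \<Longrightarrow> c' s = 0"
proof
  define c where "c s = (pos_square (s/d - 1) - 2 * pos_square (s/d - 2) + pos_square (s/d - 3)) / 2" for s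
  define c' where "c' s = (max 0 (s/d - 1) - 2 * max 0 (s/d - 2) + max 0 (s/d - 3)) / d" for s
  note D = DERIV_chain2[OF DERIV_pos_square]
  show der: "(c has_real_derivative c' s) (at s)" for s
    unfolding c_def c'_def
    by (rule derivative_eq_intros D refl | use assms in \<open>simp add: field_simps\<close>)+
  show "continuous_on UNIV c'" unfolding c'_def
    using assms by (intro continuous_intros) auto
  have "0 \<le> max 0 (z - 1) - 2 * max 0 (z - 2) + max 0 (z - 3)" for z :: real
    by (simp add: max_def)
  then show nn: "0 \<le> c' s" for s
    using assms by (simp add: c'_def)
  show lo: "c s = 0" if "s \<le> d" for s
    using that assms by (auto simp: c_def pos_square_def max_def field_simps)
  show "c' s = 0" if "s \<le> d" for s
    using that assms by (auto simp: c'_def max_def field_simps)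
  have q: "s/d \<ge> 3" if "s \<ge> 3 * d" for s using that assms by (simp add: field_simps)
  show hi: "c s = 1" if "s \<ge> 3 * d" for s
    using q[OF that] by (simp add: c_def pos_square_def max_def power2_eq_square algebra_simps)
  show "c' s = 0" if "s \<ge> 3 * d" for s
    using q[OF that] by (simp add: c'_def max_def)
  have mono: "c a \<le> c b" if "a \<le> b" for a b
    using DERIV_nonneg_imp_nondecreasing[OF that] der nn by blast
  show "0 \<le> c s" for s using mono[of "min s d" s] lo[of "min s d"] by auto
  show "c s \<le> 1" for s using mono[of s "max s (3*d)"] hi[of "max s (3*d)"] by auto
qed

section \<open>Volume growth of slabs\<close>

text \<open>Up to the factor \<open>4 / N\<^sup>2\<close>, the function
  \<open>1 / (1 + x \<bullet> x)\<close> bounds the squared gradient of the logarithmic cutoff used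
  below. Since the integral of \<open>S\<close> grows only linearly in \<open>N\<close>, the energy
  of the cutoff in the slab is O(1/N).\<close>

lemma slab_majorant:
  fixes k :: "'n::finite" and N :: nat
  assumes "CARD('n) \<le> 3" "t > 0"
  obtains S :: "real^'n \<Rightarrow> real" where "integrable lborel S" "\<And>x. 0 \<le> S x"
    "\<And>x. 0 \<le> x $ k \<Longrightarrow> x $ k \<le> t \<Longrightarrow> ln (1 + x \<bullet> x) < N \<Longrightarrow> 1 / (1 + x \<bullet> x) \<le> S x"
    "integral\<^sup>L lborel S \<le> 4 * exp 1 * t * N"
proof
  \<comment> \<open>on the shell \<open>e\<^sup>j \<le> 1 + |x|\<^sup>2 < e\<^bsup>j+1\<^esup>\<close> the function is at most \<open>e\<^bsup>-j\<^esup>\<close>, and the slab part of the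
    shell has measure \<open>O(t e\<^sup>j)\<close> because at most two directions are unbounded\<close>
  define r where "r j = exp ((real j + 1) / 2)" for j :: nat
  have r2: "(r j)\<^sup>2 = exp (real j + 1)" for j
    by (simp add: r_def power2_eq_square flip: exp_add)
  have r: "r j \<ge> 1" for j by (simp add: r_def)
  define Q where "Q j = cbox (\<chi> i. if i = k then 0 else - r j) ((\<chi> i. if i = k then t else r j) :: real^'n)" for j
  define S where "S x = (\<Sum>j<N. exp (- real j) * indicator (Q j) x)" for x :: "real^'n"
  have "measure lborel (Q j) \<le> t * (4 * exp (real j + 1))" for j
  proof -
    have "Q j \<noteq> {}"
      unfolding Q_def interval_ne_empty_cart using assms r[of j] by auto
    then have "measure lborel (Q j) = (\<Prod>i\<in>UNIV. (if i = k then t else 2 * r j))"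
      unfolding Q_def by (subst content_cbox_cart) (assumption, intro prod.cong, simp_all)
    also have "\<dots> = t * (\<Prod>i\<in>UNIV - {k}. 2 * r j)"
      by (subst prod.remove[of _ k]) (auto intro!: prod.cong)
    also have "\<dots> = t * (2 * r j) ^ (CARD('n) - 1)" by simp
    \<comment> \<open>The dimension bound enters here: besides \<open>k\<close> there are at most
      two directions.\<close>
    also have "(2 * r j) ^ (CARD('n) - 1) \<le> (2 * r j) ^ 2"
      using assms(1) r[of j] by (intro power_increasing) auto
    also have "(2 * r j) ^ 2 = 4 * exp (real j + 1)" by (simp add: power_mult_distrib r2)
    finally show ?thesis using assms(2) by simp
  qed
  then have "exp (- real j) * measure lborel (Q j) \<le> exp (- real j) * (t * (4 * exp (real j + 1)))" for j
    by (intro mult_left_mono) auto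
  then have m: "exp (- real j) * measure lborel (Q j) \<le> 4 * exp 1 * t" for j
    by (simp add: exp_add exp_minus field_simps)
  have int: "integrable lborel (\<lambda>x. exp (- real j) * indicator (Q j) x)" for j
    unfolding Q_def
    by (intro integrable_mult_right integrable_real_indicator) (simp, rule emeasure_lborel_cbox_finite)
  show "integrable lborel S" unfolding S_def by (intro Bochner_Integration.integrable_sum int)
  have "integral\<^sup>L lborel S = (\<Sum>j<N. exp (- real j) * measure lborel (Q j))"
    unfolding S_def Bochner_Integration.integral_sum[OF int] integral_mult_right_zero
    by (simp add: Q_def)
  also have "\<dots> \<le> (\<Sum>j<N. 4 * exp 1 * t)" using m by (intro sum_mono) auto
  finally show "integral\<^sup>L lborel S \<le> 4 * exp 1 * t * N" by (simp add: mult.commute)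
  show "0 \<le> S x" for x by (auto simp: S_def intro!: sum_nonneg)
  fix x :: "real^'n" assume x: "0 \<le> x $ k" "x $ k \<le> t" "ln (1 + x \<bullet> x) < N"
  define l where "l = ln (1 + x \<bullet> x)"
  have pos: "1 + x \<bullet> x > 0" by (smt (verit) inner_ge_zero)
  have l: "l \<ge> 0" "exp l = 1 + x \<bullet> x" using pos by (auto simp: l_def)
  define j where "j = nat \<lfloor>l\<rfloor>"
  have j: "real j \<le> l" "l < real j + 1" using l(1) by (auto simp: j_def)
  then have "j < N" using x(3) by (simp add: l_def)
  have "exp l < exp (real j + 1)" using j by simp
  then have "(norm x)\<^sup>2 \<le> (r j)\<^sup>2" using l(2) by (simp add: r2 power2_norm_eq_inner)
  then have "norm x \<le> r j" using r[of j] by (auto intro: power2_le_imp_le)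
  then have "\<bar>x $ i\<bar> \<le> r j" for i using component_le_norm_cart[of x i] by linarith
  then have "x \<in> Q j" using x by (auto simp: Q_def mem_box_cart abs_le_iff minus_le_iff)
  have "1 / (1 + x \<bullet> x) = exp (- l)" using l(2) by (simp add: exp_minus field_simps)
  also have "\<dots> \<le> exp (- real j) * indicator (Q j) x" using j \<open>x \<in> Q j\<close> by simp
  also have "\<dots> \<le> S x" unfolding S_def using \<open>j < N\<close> by (intro member_le_sum) auto
  finally show "1 / (1 + x \<bullet> x) \<le> S x" .
qed

lemma has_derivative_partials:
  fixes f :: "real^'n \<Rightarrow> real"
  assumes "f differentiable (at x)"
  shows "(f has_derivative (\<lambda>h. \<Sum>i\<in>UNIV. h $ i * partial i f x)) (at x)"
proof -
  have D: "(f has_derivative frechet_derivative f (at x)) (at x)"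
    using assms frechet_derivative_works by blast
  have "frechet_derivative f (at x) h = (\<Sum>i\<in>UNIV. h $ i * partial i f x)" for h
  proof -
    have "frechet_derivative f (at x) h = frechet_derivative f (at x) (\<Sum>i\<in>UNIV. h $ i *\<^sub>R axis i 1)"
      by (simp add: basis_expansion flip: scalar_mult_eq_scaleR)
    then show ?thesis
      using has_derivative_linear[OF D]
      by (simp add: partial_within_def linear_sum linear_scale)
  qed
  then have "frechet_derivative f (at x) = (\<lambda>h. \<Sum>i\<in>UNIV. h $ i * partial i f x)" by blast
  then show ?thesis using D by simp
qed

section \<open>Regularity in the phase and near the free boundary\<close>

locale one_phase_gradient_bound =
  fixes u :: "real^'n \<Rightarrow> real"
  assumes solution: "one_phase_solution u"
    and norm_grad_le: "x \<in> positive_phase u \<Longrightarrow> norm (grad u x) \<le> 1"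
begin

abbreviation "\<Xi> \<equiv> positive_phase u"

lemma open_phase: "open \<Xi>"
  and C1_closure_phase: "C1_closure \<Xi> u"
  and harmonic_phase: "harmonic_on \<Xi> u"
  and norm_grad_frontier: "x \<in> frontier \<Xi> \<Longrightarrow> norm (grad_within (closure \<Xi>) u x) = 1"
  using solution by (auto simp: one_phase_solution_def Let_def)

lemma continuous_on_closure: "continuous_on (closure \<Xi>) u"
  using C1_closure_phase by (auto simp: C1_closure_def intro: differentiable_imp_continuous_on)

text \<open>The phase is open, hence lies in the interior of its closure, where both derivatives use
  the same filter.\<close>

lemma grad_within_eq_grad: "x \<in> \<Xi> \<Longrightarrow> grad_within (closure \<Xi>) u x = grad u x"
  using at_within_interior[of x "closure \<Xi>"] interior_maximal[OF closure_subset open_phase]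
  by (auto simp: grad_within_def partial_within_def)

lemma C2_phase:
  "u differentiable_on \<Xi>" "partial i u differentiable_on \<Xi>"
  "continuous_on \<Xi> (partial j (partial i u))"
  using harmonic_phase by (auto simp: harmonic_on_def numeral_2_eq_2)

lemma has_derivative_u:
  assumes "x \<in> \<Xi>"
  shows "(u has_derivative (\<lambda>h. grad u x \<bullet> h)) (at x)"
  using has_derivative_partials[of u x] C2_phase(1) assms open_phase
  by (simp add: differentiable_on_eq_differentiable_at inner_vec_def grad_within_def mult.commute)

lemma has_derivative_partial:
  assumes "x \<in> \<Xi>"
  shows "(partial i u has_derivative (\<lambda>h. \<Sum>j\<in>UNIV. h $ j * partial j (partial i u) x)) (at x)"
  using has_derivative_partials[of "partial i u" x] C2_phase(2) assms open_phase
  by (simp add: differentiable_on_eq_differentiable_at)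

lemma continuous_on_partial: "continuous_on \<Xi> (partial i u)"
  using C2_phase(2) by (rule differentiable_imp_continuous_on)

lemma continuous_on_grad: "continuous_on \<Xi> (grad u)"
  unfolding grad_within_def by (intro continuous_on_vec_lambda continuous_on_partial)

text \<open>The points of \<open>C\<close> in the closed phase with gradient norm at most
  \<open>1 - \<omega>\<close> form a compact set, by continuity of the gradient up to the boundary.
  This set misses the free boundary, so \<open>u\<close> has a positive lower bound on it.\<close>

lemma norm_grad_near_free_boundary:
  assumes "compact C" "\<omega> > 0"
  obtains d where "d > 0" "\<And>x. x \<in> C \<Longrightarrow> x \<in> \<Xi> \<Longrightarrow> u x < d \<Longrightarrow> norm (grad u x) \<ge> 1 - \<omega>"
proof -
  define T where "T = {x \<in> C \<inter> closure \<Xi>. norm (grad_within (closure \<Xi>) u x) \<le> 1 - \<omega>}"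
  have c: "continuous_on (C \<inter> closure \<Xi>) (\<lambda>x. norm (grad_within (closure \<Xi>) u x))"
    using C1_closure_phase
    by (auto simp: C1_closure_def intro!: continuous_intros intro: continuous_on_subset)
  have CC: "compact (C \<inter> closure \<Xi>)" using assms by (simp add: compact_Int_closed)
  have "compact T"
    unfolding T_def using continuous_closedin_preimage[OF c closed_atMost[of "1-\<omega>"]]
    by (intro closedin_compact[OF CC]) (simp add: vimage_def Int_def)
  have pos: "u x > 0" if "x \<in> T" for x
  proof (rule ccontr)
    assume "\<not> u x > 0"
    then have "x \<notin> \<Xi>" by (simp add: positive_phase_def)
    then have "x \<in> frontier \<Xi>" using that open_phase by (auto simp: T_def frontier_def interior_open)
    then show False using norm_grad_frontier[of x] that assms by (auto simp: T_def)
  qed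
  obtain d where d: "d > 0" "\<And>x. x \<in> T \<Longrightarrow> d \<le> u x"
  proof (cases "T = {}")
    case True then show ?thesis using that[of 1] by auto
  next
    case False
    have "continuous_on T u" using continuous_on_closure
      by (rule continuous_on_subset) (auto simp: T_def)
    then obtain y where "y \<in> T" "\<And>x. x \<in> T \<Longrightarrow> u y \<le> u x"
      using continuous_attains_inf[OF \<open>compact T\<close> False] by blast
    then show ?thesis using that[of "u y"] pos by auto
  qed
  show ?thesis
  proof (rule that[OF d(1)])
    fix x assume "x \<in> C" "x \<in> \<Xi>" "u x < d"
    then have "x \<notin> T" using d(2) by force
    moreover have "x \<in> closure \<Xi>" using \<open>x \<in> \<Xi>\<close> closure_subset by blast
    ultimately show "norm (grad u x) \<ge> 1 - \<omega>"
      using \<open>x \<in> C\<close> \<open>x \<in> \<Xi>\<close> by (auto simp: T_def grad_within_eq_grad)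
  qed
qed

section \<open>Flux through the free boundary\<close>

text \<open>
  Weak form of \<open>\<integral> X \<bullet> \<nabla>\<zeta> \<ge> 0\<close>. The cutoff \<open>c (u x)\<close> near the free boundary replaces the divergence
  theorem on the phase: testing the divergence-free fields \<open>e\<^sub>k\<close> and \<open>\<nabla>u\<close> with \<open>\<zeta> c(u)\<close> leaves the terms
  \<open>\<zeta> c'(u) \<partial>\<^sub>ku\<close> and \<open>\<zeta> c'(u) |\<nabla>u|\<^sup>2\<close>, and the first is at most \<open>1 + \<omega>\<close> times the second because
  \<open>c'(u)\<close> lives where \<open>|\<nabla>u|\<close> is close to 1.
\<close>

lemma flux_inequality:
  fixes \<zeta> :: "real^'n \<Rightarrow> real" and Z :: "real^'n \<Rightarrow> real^'n" and k :: 'n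
  assumes \<zeta>: "\<And>x. 0 \<le> \<zeta> x" "\<And>x. (\<zeta> has_derivative (\<lambda>h. Z x \<bullet> h)) (at x)" "continuous_on UNIV Z"
    and supp: "\<And>x. norm x > R \<Longrightarrow> \<zeta> x = 0" "\<And>x. norm x > R \<Longrightarrow> Z x = 0"
    and "\<omega> > 0" "\<eta> > 0"
  obtains c where "\<And>s. 0 \<le> c s" "\<And>s. c s \<le> 1" "\<And>s. s \<le> 0 \<Longrightarrow> c s = 0" "\<And>s. s \<ge> \<eta> \<Longrightarrow> c s = (1::real)"
    "integrable lborel (\<lambda>x. c (u x) * ((axis k 1 - grad u x) \<bullet> Z x))"
    "- \<omega> * (\<integral>x. norm (Z x) \<partial>lborel) \<le> (\<integral>x. c (u x) * ((axis k 1 - grad u x) \<bullet> Z x) \<partial>lborel)"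
proof -
  \<comment> \<open>With this choice \<open>|\<nabla>u| \<ge> 1 - \<omega>'\<close> becomes
    \<open>1 \<le> (1 + \<omega>) |\<nabla>u|\<close>.\<close>
  define \<omega>' where "\<omega>' = \<omega> / (1 + \<omega>)"
  have \<omega>': "\<omega>' > 0" "(1 + \<omega>) * (1 - \<omega>') = 1" using \<open>\<omega> > 0\<close> by (auto simp: \<omega>'_def field_simps)
  obtain d1 where d1: "d1 > 0"
    "\<And>x. x \<in> cball 0 R \<Longrightarrow> x \<in> \<Xi> \<Longrightarrow> u x < d1 \<Longrightarrow> norm (grad u x) \<ge> 1 - \<omega>'"
    using norm_grad_near_free_boundary[OF compact_cball \<omega>'(1)] by blast
  \<comment> \<open>The step \<open>c\<close> rises on \<open>[d, 3 * d]\<close>; this places the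
    support of \<open>c'\<close> below \<open>d1\<close> and makes \<open>c\<close> equal to 1 from
    \<open>\<eta>\<close> on.\<close>
  define d where "d = min d1 \<eta> / 3"
  have d: "d > 0" "3 * d \<le> d1" "3 * d \<le> \<eta>" using d1(1) \<open>\<eta> > 0\<close> by (auto simp: d_def)
  obtain c c' where c: "\<And>s. (c has_real_derivative c' s) (at s)" "continuous_on UNIV c'"
    "\<And>s. 0 \<le> c' s" "\<And>s. 0 \<le> c s" "\<And>s. c s \<le> 1"
    "\<And>s. s \<le> d \<Longrightarrow> c s = 0" "\<And>s. s \<le> d \<Longrightarrow> c' s = 0"
    "\<And>s. s \<ge> 3 * d \<Longrightarrow> c s = 1" "\<And>s. s \<ge> 3 * d \<Longrightarrow> c' s = 0"
    using ex_C1_step[OF d(1)] by blast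
  \<comment> \<open>The bound \<open>d \<le> u x\<close> keeps \<open>K\<close> at a positive level
    of \<open>u\<close>, hence inside the open phase, where \<open>u\<close> is C^2. All integrands
    below vanish off \<open>K\<close>.\<close>
  define K where "K = {x \<in> cball 0 R \<inter> closure \<Xi>. d \<le> u x}"
  have KX: "K \<subseteq> \<Xi>" using d(1) by (auto simp: K_def positive_phase_def)
  have "compact K"
  proof -
    have "continuous_on (cball 0 R \<inter> closure \<Xi>) u"
      using continuous_on_closure by (rule continuous_on_subset) auto
    from continuous_closedin_preimage[OF this closed_atLeast[of d]]
    show ?thesis unfolding K_def
      by (intro closedin_compact[OF compact_Int_closed[OF compact_cball[of 0 R] closed_closure[of \<Xi>]]])
        (simp add: vimage_def Int_def)
  qed
  have offK: "c (u x) = 0 \<and> c' (u x) = 0 \<or> \<zeta> x = 0 \<and> Z x = 0" if "x \<notin> K" for x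
  proof (cases "u x \<le> d")
    case False
    then have "x \<in> \<Xi>" using d(1) by (auto simp: positive_phase_def)
    then have "norm x > R" using that False closure_subset[of \<Xi>] by (auto simp: K_def)
    then show ?thesis using supp by blast
  qed (use c in auto)
  have contc: "continuous_on UNIV c"
    by (rule DERIV_continuous_on[of UNIV c c']) (simp add: c(1))
  have cont\<zeta>: "continuous_on UNIV \<zeta>"
    using \<zeta>(2) by (meson has_derivative_continuous continuous_at_imp_continuous_on)
  have contu: "continuous_on K u" using continuous_on_closure
    by (rule continuous_on_subset) (auto simp: K_def)
  note cont_rules = continuous_on_compose2[OF contc contu] continuous_on_compose2[OF c(2) contu]
    continuous_on_subset[OF cont\<zeta>] continuous_on_subset[OF \<zeta>(3)]
    continuous_on_subset[OF continuous_on_partial KX] continuous_on_subset[OF continuous_on_grad KX]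
    continuous_on_subset[OF C2_phase(3) KX]
  have line: "((\<lambda>s. F (x + s *\<^sub>R e)) has_real_derivative F' e) (at 0)"
    if "(F has_derivative F') (at x)" for F :: "real^'n \<Rightarrow> real" and F' x e
  proof -
    have "((\<lambda>s. F (x + s *\<^sub>R e)) has_derivative (\<lambda>s. F' (s *\<^sub>R e))) (at 0)"
      by (rule has_derivative_compose[of "\<lambda>s. x + s *\<^sub>R e" "\<lambda>s. s *\<^sub>R e" 0 UNIV F F'])
        (use that in \<open>auto intro!: derivative_eq_intros\<close>)
    then show ?thesis
      using linear_scale[OF has_derivative_linear[OF that]]
      by (simp add: has_field_derivative_def mult.commute[of _ "F' e"])
  qed
  have dcu: "((\<lambda>x. c (u x)) has_derivative (\<lambda>h. (grad u x \<bullet> h) * c' (u x))) (at x)" if "x \<in> K" for x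
  proof -
    have "(c has_derivative (\<lambda>s. s * c' (u x))) (at (u x))"
      using c(1)[of "u x"] unfolding has_field_derivative_def
      by (rule has_derivative_eq_rhs) (simp add: fun_eq_iff)
    then show ?thesis using has_derivative_compose[OF has_derivative_u] that KX by blast
  qed
  \<comment> \<open>\<open>?P\<close> is the divergence of \<open>\<zeta> c(u) e\<^sub>k\<close>,
    and \<open>?D i\<close> is the \<open>i\<close>-th term of the divergence of
    \<open>\<zeta> c(u) \<nabla>u\<close>. Their sum over \<open>i\<close> is \<open>?Q\<close>
    because the Laplacian term drops out.\<close>
  let ?P = "\<lambda>x. c (u x) * Z x $ k + \<zeta> x * c' (u x) * grad u x $ k"
  let ?Q = "\<lambda>x. c (u x) * (grad u x \<bullet> Z x) + \<zeta> x * c' (u x) * (grad u x \<bullet> grad u x)"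
  let ?D = "\<lambda>i x. c (u x) * Z x $ i * partial i u x + \<zeta> x * c' (u x) * (partial i u x * partial i u x)
    + \<zeta> x * c (u x) * partial i (partial i u) x"
  have P: "integrable lborel ?P" "integral\<^sup>L lborel ?P = 0"
  proof -
    have 1: "continuous_on K (\<lambda>x. \<zeta> x * c (u x))" "continuous_on K ?P"
      by (intro continuous_intros cont_rules subset_UNIV)+
    have 2: "\<zeta> x * c (u x) = 0" "?P x = 0" if "x \<notin> K" for x using offK[OF that] by auto
    have 3: "((\<lambda>s. \<zeta> (x + s *\<^sub>R axis k 1) * c (u (x + s *\<^sub>R axis k 1))) has_real_derivative ?P x) (at 0)" if "x \<in> K" for x
      using line[OF has_derivative_mult[OF \<zeta>(2) dcu[OF that]], of "axis k 1"]
      by (simp add: inner_axis algebra_simps)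
    show "integrable lborel ?P" "integral\<^sup>L lborel ?P = 0"
      using integral_directional_derivative_eq_0[OF \<open>compact K\<close> 1 2 3] by auto
  qed
  have D: "integrable lborel (?D i)" "integral\<^sup>L lborel (?D i) = 0" for i
  proof -
    have 1: "continuous_on K (\<lambda>x. \<zeta> x * c (u x) * partial i u x)" "continuous_on K (?D i)"
      by (intro continuous_intros cont_rules subset_UNIV)+
    have 2: "\<zeta> x * c (u x) * partial i u x = 0" "?D i x = 0" if "x \<notin> K" for x using offK[OF that] by auto
    have 3: "((\<lambda>s. \<zeta> (x + s *\<^sub>R axis i 1) * c (u (x + s *\<^sub>R axis i 1)) * partial i u (x + s *\<^sub>R axis i 1))
        has_real_derivative ?D i x) (at 0)" if "x \<in> K" for x
    proof -
      have e: "(\<Sum>j\<in>UNIV. (axis i 1 :: real^'n) $ j * partial j (partial i u) x) = partial i (partial i u) x"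
        by (simp add: axis_def if_distrib[of "\<lambda>a. a * _"] cong: if_cong)
      show ?thesis
        using line[OF has_derivative_mult[OF has_derivative_mult[OF \<zeta>(2) dcu[OF that]]
              has_derivative_partial[of x i]], of "axis i 1"] that KX
        by (simp add: e inner_axis algebra_simps subset_iff grad_within_def)
    qed
    show "integrable lborel (?D i)" "integral\<^sup>L lborel (?D i) = 0"
      using integral_directional_derivative_eq_0[OF \<open>compact K\<close> 1 2 3] by auto
  qed
  have Q_eq: "?Q = (\<lambda>x. \<Sum>i\<in>UNIV. ?D i x)"
  proof
    fix x
    have "\<zeta> x * c (u x) * (\<Sum>i\<in>UNIV. partial i (partial i u) x) = 0"
    proof (cases "x \<in> K")
      case True
      then show ?thesis using harmonic_phase KX by (auto simp: harmonic_on_def laplacian_def)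
    qed (use offK in auto)
    then show "?Q x = (\<Sum>i\<in>UNIV. ?D i x)"
      by (simp add: sum.distrib inner_vec_def sum_distrib_left grad_within_def algebra_simps)
  qed
  have Q: "integrable lborel ?Q" "integral\<^sup>L lborel ?Q = 0"
    unfolding Q_eq using D by (auto simp del: sum.distrib)
  have intZ: "integrable lborel (\<lambda>x. norm (Z x))"
  proof -
    have "integrable lborel (\<lambda>x. indicator (cball 0 R) x *\<^sub>R norm (Z x))"
      by (intro borel_integrable_compact continuous_intros continuous_on_subset[OF \<zeta>(3)]) auto
    moreover have "(\<lambda>x. indicator (cball 0 R) x *\<^sub>R norm (Z x)) = (\<lambda>x. norm (Z x))"
      using supp(2) by (auto simp: indicator_def fun_eq_iff)
    ultimately show ?thesis by simp
  qed
  let ?X = "\<lambda>x. c (u x) * ((axis k 1 - grad u x) \<bullet> Z x)"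
  have intX: "integrable lborel ?X"
  proof -
    have "integrable lborel (\<lambda>x. indicator K x *\<^sub>R ?X x)"
      using \<open>compact K\<close> by (intro borel_integrable_compact continuous_intros cont_rules subset_UNIV)
    moreover have "(\<lambda>x. indicator K x *\<^sub>R ?X x) = ?X"
      using offK by (fastforce simp: indicator_def fun_eq_iff)
    ultimately show ?thesis by simp
  qed
  \<comment> \<open>In the phase, \<open>?P - (1 + \<omega>) ?Q\<close> equals \<open>?X\<close>
    plus two terms: \<open>\<zeta> c'(u) (\<partial>\<^sub>ku - (1 + \<omega>)
    |\<nabla>u|\<^sup>2)\<close>, which is nonpositive, and
    \<open>- \<omega> c(u) \<nabla>u \<bullet> Z\<close>, which is at most
    \<open>\<omega> |Z|\<close>.\<close>
  have point: "?P x - (1 + \<omega>) * ?Q x - \<omega> * norm (Z x) \<le> ?X x" for x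
  proof (cases "x \<in> \<Xi>")
    case False
    then have "c (u x) = 0" "c' (u x) = 0" using c(6,7)[of "u x"] d(1) by (auto simp: positive_phase_def)
    then show ?thesis using \<open>\<omega> > 0\<close> by simp
  next
    case True
    let ?V = "grad u x"
    have V: "norm ?V \<le> 1" using norm_grad_le True .
    have "\<zeta> x * c' (u x) * ?V $ k \<le> (1 + \<omega>) * (\<zeta> x * c' (u x) * (?V \<bullet> ?V))"
    proof (cases "\<zeta> x = 0 \<or> c' (u x) = 0")
      case False
      then have "x \<in> cball 0 R" "u x < d1" using supp(1)[of x] c(9)[of "u x"] d(2) by force+
      then have "norm ?V \<ge> 1 - \<omega>'" using d1(2) True by blast
      then have "(1 + \<omega>) * (1 - \<omega>') \<le> (1 + \<omega>) * norm ?V"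
        using \<open>\<omega> > 0\<close> by (intro mult_left_mono) auto
      then have "1 \<le> (1 + \<omega>) * norm ?V" using \<omega>'(2) by simp
      then have "1 * norm ?V \<le> (1 + \<omega>) * norm ?V * norm ?V" by (intro mult_right_mono) auto
      moreover have "?V $ k \<le> norm ?V" using component_le_norm_cart[of ?V k] by linarith
      ultimately have "?V $ k \<le> (1 + \<omega>) * (?V \<bullet> ?V)"
        by (simp add: power2_norm_eq_inner[symmetric] power2_eq_square mult.assoc)
      from mult_left_mono[OF this, of "\<zeta> x * c' (u x)"] show ?thesis
        using \<zeta>(1) c(3) by (simp add: algebra_simps)
    qed auto
    moreover have "- norm (Z x) \<le> c (u x) * (?V \<bullet> Z x)"
    proof -
      have "\<bar>c (u x) * (?V \<bullet> Z x)\<bar> \<le> 1 * (norm ?V * norm (Z x))"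
        unfolding abs_mult using c(4,5)[of "u x"] by (intro mult_mono Cauchy_Schwarz_ineq2) auto
      also have "\<dots> \<le> norm (Z x)" using V by (simp add: mult_left_le_one_le)
      finally show ?thesis by linarith
    qed
    from mult_left_mono[OF this, of \<omega>] have "- \<omega> * norm (Z x) \<le> \<omega> * (c (u x) * (?V \<bullet> Z x))"
      using \<open>\<omega> > 0\<close> by simp
    ultimately show ?thesis
      by (simp add: inner_diff_left inner_axis' algebra_simps)
  qed
  have "(\<integral>x. ?P x - (1 + \<omega>) * ?Q x - \<omega> * norm (Z x) \<partial>lborel) \<le> integral\<^sup>L lborel ?X"
    using P(1) Q(1) intZ intX point by (intro integral_mono) auto
  moreover have "(\<integral>x. ?P x - (1 + \<omega>) * ?Q x - \<omega> * norm (Z x) \<partial>lborel)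
      = - \<omega> * (\<integral>x. norm (Z x) \<partial>lborel)"
    using P Q intZ by (simp del: integral_add integral_mult_left)
  ultimately have "- \<omega> * (\<integral>x. norm (Z x) \<partial>lborel) \<le> integral\<^sup>L lborel ?X" by simp
  then show ?thesis
    using c(4-6,8) d intX by (intro that[of c]) auto
qed

section \<open>Rigidity of the gradient\<close>

text \<open>If \<open>X\<close> were nonzero at \<open>x0\<close>, a small ball around
  \<open>x0\<close> would contribute a fixed loss \<open>\<kappa>\<close> to the flux. The order of
  choices matters: first the ball and \<open>\<kappa>\<close>, then \<open>N\<close> to make the
  cutoff cheap, and last \<open>\<omega>\<close>, which depends on \<open>Z\<close> and so on
  \<open>N\<close>.\<close>

lemma grad_eq_axis:
  assumes card: "CARD('n) \<le> 3" and half: "\<Xi> \<subseteq> {x. x $ k > 0}" and x0: "x0 \<in> \<Xi>"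
  shows "grad u x0 = axis k 1"
proof (rule ccontr)
  assume "grad u x0 \<noteq> axis k 1"
  define X where "X x = axis k 1 - grad u x" for x
  \<comment> \<open>Points within distance 1 of \<open>x0\<close> have height at most
    \<open>t - 1\<close>, so \<open>t - x $ k\<close> is at least 1 there.\<close>
  define t where "t = x0 $ k + 2"
  have t: "t > 0" using half x0 by (auto simp: t_def)
  define \<eta> where "\<eta> = u x0 / 2"
  have \<eta>: "\<eta> > 0" using x0 by (simp add: \<eta>_def positive_phase_def)
  define b where "b = (norm (X x0))\<^sup>2 / 2"
  have b: "b > 0" using \<open>grad u x0 \<noteq> axis k 1\<close> by (simp add: b_def X_def)
  obtain r where r: "0 < r" "r \<le> 1"
    and ball: "\<And>y. y \<in> cball x0 r \<Longrightarrow> y \<in> \<Xi> \<and> b \<le> (norm (X y))\<^sup>2 \<and> \<eta> \<le> u y"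
  proof -
    have "continuous_on \<Xi> (\<lambda>y. (norm (X y))\<^sup>2)" unfolding X_def
      by (intro continuous_intros continuous_on_grad)
    then have "isCont (\<lambda>y. (norm (X y))\<^sup>2) x0" "isCont u x0"
      using x0 open_phase continuous_on_eq_continuous_at has_derivative_continuous[OF has_derivative_u] by blast+
    then have "((\<lambda>y. (norm (X y))\<^sup>2) \<longlongrightarrow> (norm (X x0))\<^sup>2) (nhds x0)" "(u \<longlongrightarrow> u x0) (nhds x0)"
      using tendsto_at_iff_tendsto_nhds[of "\<lambda>y. (norm (X y))\<^sup>2" x0] tendsto_at_iff_tendsto_nhds[of u x0]
      by (simp_all add: continuous_at)
    moreover have "b < (norm (X x0))\<^sup>2" "\<eta> < u x0" using b \<eta> by (auto simp: b_def \<eta>_def)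
    ultimately have "\<forall>\<^sub>F y in nhds x0. b < (norm (X y))\<^sup>2" "\<forall>\<^sub>F y in nhds x0. \<eta> < u y"
      by (simp_all only: order_tendstoD(1))
    moreover have "\<forall>\<^sub>F y in nhds x0. y \<in> \<Xi>" using open_phase x0 by (rule eventually_nhds_in_open)
    ultimately have "\<forall>\<^sub>F y in nhds x0. y \<in> \<Xi> \<and> b < (norm (X y))\<^sup>2 \<and> \<eta> < u y"
      by eventually_elim auto
    then obtain e where e: "e > 0" "\<And>y. dist y x0 < e \<Longrightarrow> y \<in> \<Xi> \<and> b < (norm (X y))\<^sup>2 \<and> \<eta> < u y"
      unfolding eventually_nhds_metric by blast
    show ?thesis
      by (rule that[of "min (e/2) 1"]) (use e in \<open>auto simp: dist_commute less_imp_le\<close>)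
  qed
  define B where "B = cball x0 r"
  \<comment> \<open>On \<open>B\<close> the cutoff satisfies \<open>g \<ge> 1/2\<close> and the
    height factor is at least 1, so the good term is at least
    \<open>(1/2)\<^sup>2 * 1 * b / 2 = b / 8\<close>.\<close>
  define \<kappa> where "\<kappa> = b / 8 * measure lborel B"
  have \<kappa>: "\<kappa> > 0" using b r(1) content_cball_pos[of r x0] by (simp add: \<kappa>_def B_def)
  define \<rho> where "\<rho> = norm x0 + 1"
  have normB: "norm y \<le> \<rho>" "y $ k \<le> t - 1" if "y \<in> B" for y
  proof -
    have d: "norm (y - x0) \<le> 1" using that r by (simp add: B_def dist_norm norm_minus_commute)
    then show "norm y \<le> \<rho>" using norm_triangle_sub[of y x0] by (simp add: \<rho>_def)
    show "y $ k \<le> t - 1" using component_le_norm_cart[of "y - x0" k] d by (simp add: t_def)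
  qed
  \<comment> \<open>The first bound yields \<open>g \<ge> 1/2\<close> on \<open>B\<close>; the
    second makes the cutoff cost \<open>32 * exp 1 * t ^ 4 / N\<close> less than
    \<open>\<kappa> / 2\<close>.\<close>
  obtain N :: nat where N: "N > 2 * ln (1 + \<rho>\<^sup>2)" "N > 64 * exp 1 * t ^ 4 / \<kappa>"
    using reals_Archimedean2[of "max (2 * ln (1 + \<rho>\<^sup>2)) (64 * exp 1 * t ^ 4 / \<kappa>)"] by auto
  have N0: "real N > 0" using N(2) t \<kappa> by (smt (verit) divide_nonneg_pos exp_gt_zero zero_le_power mult_nonneg_nonneg)
  obtain S :: "real^'n \<Rightarrow> real" where S: "integrable lborel S" "\<And>x. 0 \<le> S x"
    "\<And>x. 0 \<le> x $ k \<Longrightarrow> x $ k \<le> t \<Longrightarrow> ln (1 + x \<bullet> x) < N \<Longrightarrow> 1 / (1 + x \<bullet> x) \<le> S x"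
    "integral\<^sup>L lborel S \<le> 4 * exp 1 * t * N"
    using slab_majorant[OF card t] by blast
  \<comment> \<open>The logarithmic cutoff, with gradient \<open>G\<close>; its positive part tends
    to 1 locally as \<open>N\<close> grows and vanishes beyond radius
    \<open>e\<^sup>N\<^sup>/\<^sup>2\<close>.\<close>
  define g where "g x = 1 - ln (1 + x \<bullet> x) / N" for x :: "real^'n"
  define G where "G x = (- 2 / ((1 + x \<bullet> x) * N)) *\<^sub>R x" for x :: "real^'n"
  define \<zeta> where "\<zeta> x = pos_square (g x) * pos_square (t - x $ k)" for x
  define Z where "Z x = (2 * max 0 (g x) * pos_square (t - x $ k)) *\<^sub>R G x
      - (2 * max 0 (t - x $ k) * pos_square (g x)) *\<^sub>R axis k 1" for x
  have pos: "1 + x \<bullet> x > 0" for x :: "real^'n" by (smt (verit) inner_ge_zero)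
  have dps: "((\<lambda>x. pos_square (f x)) has_derivative (\<lambda>h. f' h * (2 * max 0 (f x)))) (at x)"
    if "(f has_derivative f') (at x)" for f :: "real^'n \<Rightarrow> real" and f' x
  proof -
    have "(pos_square has_derivative (\<lambda>s. s * (2 * max 0 (f x)))) (at (f x))"
      using DERIV_pos_square[of "f x"] unfolding has_field_derivative_def
      by (rule has_derivative_eq_rhs) (simp add: fun_eq_iff)
    then show ?thesis by (rule has_derivative_compose[OF that])
  qed
  have dg: "(g has_derivative (\<lambda>h. G x \<bullet> h)) (at x)" for x
  proof -
    have "((\<lambda>x. 1 + x \<bullet> x) has_derivative (\<lambda>h. 2 * (x \<bullet> h))) (at x)"
      by (auto intro!: derivative_eq_intros simp: inner_commute)
    from has_derivative_diff[OF has_derivative_const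
        bounded_linear.has_derivative[OF bounded_linear_divide has_derivative_ln[OF pos this]]]
    show ?thesis
      unfolding g_def by (rule has_derivative_eq_rhs) (simp add: G_def fun_eq_iff divide_inverse)
  qed
  have dk: "((\<lambda>x. t - x $ k) has_derivative (\<lambda>h. - (h $ k))) (at x)" for x :: "real^'n"
    using has_derivative_diff[OF has_derivative_const bounded_linear_imp_has_derivative[OF bounded_linear_vec_nth]]
    by simp
  have d\<zeta>: "(\<zeta> has_derivative (\<lambda>h. Z x \<bullet> h)) (at x)" for x
  proof -
    have "(\<lambda>h. Z x \<bullet> h) = (\<lambda>h. pos_square (g x) * (- (h $ k) * (2 * max 0 (t - x $ k)))
        + (G x \<bullet> h) * (2 * max 0 (g x)) * pos_square (t - x $ k))"
      by (auto simp: Z_def inner_diff_left inner_axis' algebra_simps)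
    then show ?thesis
      unfolding \<zeta>_def using has_derivative_mult[OF dps[OF dg] dps[OF dk]] by simp
  qed
  have contps: "continuous_on UNIV pos_square"
    unfolding pos_square_def by (intro continuous_intros)
  have contg: "continuous_on UNIV g"
    using dg by (meson has_derivative_continuous continuous_at_imp_continuous_on)
  have contZ: "continuous_on UNIV Z"
    unfolding Z_def G_def
    by (intro continuous_intros contg continuous_on_compose2[OF contps])
      (use pos N0 in \<open>auto simp: less_imp_neq[symmetric] intro: contg\<close>)
  define R where "R = sqrt (exp N)"
  have g0: "g x \<le> 0" if "norm x > R" for x
  proof -
    have "R\<^sup>2 < (norm x)\<^sup>2" using that by (intro power_strict_mono) (auto simp: R_def)
    then have "exp N < 1 + x \<bullet> x" by (simp add: R_def power2_norm_eq_inner)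
    then have "N < ln (1 + x \<bullet> x)" using pos[of x] by (metis exp_less_cancel_iff exp_ln)
    then show ?thesis using N0 by (simp add: g_def field_simps)
  qed
  \<comment> \<open>The added 1 keeps the denominator positive even if \<open>Z\<close> has integral
    0.\<close>
  define \<omega> where "\<omega> = \<kappa> / (4 * (1 + (\<integral>x. norm (Z x) \<partial>lborel)))"
  have nnZ: "0 \<le> (\<integral>x. norm (Z x) \<partial>lborel)" by simp
  have \<omega>: "\<omega> > 0" "\<omega> * (\<integral>x. norm (Z x) \<partial>lborel) \<le> \<kappa> / 4"
  proof -
    have "0 < \<kappa> / (4 * (1 + I)) \<and> \<kappa> / (4 * (1 + I)) * I \<le> \<kappa> / 4" if "I \<ge> 0" for I :: real
      using \<kappa> that by (simp add: field_simps)
    from this[OF nnZ] show "\<omega> > 0" "\<omega> * (\<integral>x. norm (Z x) \<partial>lborel) \<le> \<kappa> / 4"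
      by (simp_all only: \<omega>_def)
  qed
  obtain c where c: "\<And>s. 0 \<le> c s" "\<And>s. c s \<le> 1" "\<And>s. s \<le> 0 \<Longrightarrow> c s = 0"
      "\<And>s. s \<ge> \<eta> \<Longrightarrow> c s = (1::real)"
    and flux: "integrable lborel (\<lambda>x. c (u x) * (X x \<bullet> Z x))"
      "- \<omega> * (\<integral>x. norm (Z x) \<partial>lborel) \<le> (\<integral>x. c (u x) * (X x \<bullet> Z x) \<partial>lborel)"
    unfolding X_def
  proof (rule flux_inequality[of \<zeta> Z R \<omega> \<eta> k])
    show "0 \<le> \<zeta> x" for x by (simp add: \<zeta>_def pos_square_def)
    show "\<zeta> x = 0" "Z x = 0" if "norm x > R" for x
      using g0[OF that] by (simp_all add: \<zeta>_def Z_def pos_square_def max_absorb1)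
  qed (use d\<zeta> contZ \<omega> \<eta> in auto)
  have point: "c (u x) * (X x \<bullet> Z x) \<le> 8 * t ^ 3 / N\<^sup>2 * S x - b / 8 * indicator B x" for x
  proof (cases "x \<in> \<Xi>")
    case False
    then have "c (u x) = 0" "x \<notin> B" using c(3)[of "u x"] ball[of x] by (auto simp: positive_phase_def B_def)
    then show ?thesis using S(2)[of x] t by simp
  next
    case True
    define m p where "m = max 0 (t - x $ k)" and "p = max 0 (g x)"
    have mp: "0 \<le> m" "m \<le> t" "0 \<le> p" using half True t by (auto simp: m_def p_def)
    \<comment> \<open>This is where the gradient bound controls all of \<open>X\<close> by its
      \<open>k\<close>-th component.\<close>
    have nX: "(norm (X x))\<^sup>2 \<le> 2 * X x $ k"
    proof -
      have "(norm (X x))\<^sup>2 = 1 - 2 * grad u x $ k + (norm (grad u x))\<^sup>2"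
        by (simp add: X_def power2_norm_eq_inner inner_diff_left inner_diff_right inner_axis inner_axis')
      also have "(norm (grad u x))\<^sup>2 \<le> 1" using norm_grad_le[OF True] by (simp add: power_le_one)
      finally show ?thesis by (simp add: X_def axis_def)
    qed
    define q where "q = p\<^sup>2 * m * (norm (X x))\<^sup>2 / 2"
    have q: "q \<ge> 0" using mp by (simp add: q_def)
    have key: "X x \<bullet> Z x \<le> 8 * t ^ 3 / N\<^sup>2 * S x - q"
    proof (cases "p = 0 \<or> m = 0")
      case True
      then have "X x \<bullet> Z x = 0" "q = 0"
        by (auto simp: Z_def q_def pos_square_def inner_diff_right simp flip: m_def p_def)
      then show ?thesis using S(2)[of x] t by simp
    next
      case False
      then have "g x > 0" "x $ k \<le> t" by (auto simp: p_def m_def)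
      \<comment> \<open>The half-space hypothesis gives the lower side of the slab,
        \<open>m \<noteq> 0\<close> the upper side, and \<open>g x > 0\<close> the logarithmic
        bound.\<close>
      then have S_ge: "1 / (1 + x \<bullet> x) \<le> S x"
        using S(3)[of x] half \<open>x \<in> \<Xi>\<close> N0 by (auto simp: g_def field_simps)
      have G_le: "(norm (G x))\<^sup>2 \<le> 4 / N\<^sup>2 * (1 / (1 + x \<bullet> x))"
      proof -
        have eq: "(norm (G x))\<^sup>2 = 4 / N\<^sup>2 * ((x \<bullet> x) / (1 + x \<bullet> x)\<^sup>2)"
          unfolding G_def norm_scaleR power_mult_distrib power2_norm_eq_inner
          by (simp add: power_divide power_mult_distrib)
        have "(x \<bullet> x) / (1 + x \<bullet> x)\<^sup>2 \<le> (1 + x \<bullet> x) / (1 + x \<bullet> x)\<^sup>2"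
          by (intro divide_right_mono) auto
        also have "\<dots> = 1 / (1 + x \<bullet> x)" using pos[of x] by (simp add: power2_eq_square)
        finally show ?thesis unfolding eq by (intro mult_left_mono) auto
      qed
      have nG: "(norm (G x))\<^sup>2 \<le> 4 / N\<^sup>2 * S x"
        by (rule order_trans[OF G_le mult_left_mono[OF S_ge]]) simp
      have "X x \<bullet> Z x = 2 * p * m\<^sup>2 * (X x \<bullet> G x) - m * p\<^sup>2 * (2 * X x $ k)"
        by (simp add: Z_def inner_diff_right inner_axis pos_square_def flip: p_def m_def)
      also have "\<dots> \<le> 2 * p * m\<^sup>2 * (norm (X x) * norm (G x)) - m * p\<^sup>2 * (norm (X x))\<^sup>2"
        using mp nX by (intro diff_mono mult_left_mono norm_cauchy_schwarz) auto
      \<comment> \<open>Young's inequality by completing the square; half of the good term survives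
        as \<open>q\<close>.\<close>
      also have "\<dots> = 2 * m ^ 3 * (norm (G x))\<^sup>2 - q - m / 2 * (p * norm (X x) - 2 * m * norm (G x))\<^sup>2"
        by (simp add: q_def power2_eq_square power3_eq_cube algebra_simps)
      also have "\<dots> \<le> 2 * m ^ 3 * (norm (G x))\<^sup>2 - q" using mp by simp
      also have "2 * m ^ 3 * (norm (G x))\<^sup>2 \<le> 2 * t ^ 3 * (4 / N\<^sup>2 * S x)"
        using mp nG by (intro mult_mono power_mono) auto
      finally show ?thesis by simp
    qed
    have "c (u x) * (X x \<bullet> Z x) \<le> c (u x) * (8 * t ^ 3 / N\<^sup>2 * S x) - c (u x) * q"
      using mult_left_mono[OF key c(1)[of "u x"]] by (simp add: right_diff_distrib)
    moreover have "c (u x) * (8 * t ^ 3 / N\<^sup>2 * S x) \<le> 8 * t ^ 3 / N\<^sup>2 * S x"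
      using S(2)[of x] t c(1,2)[of "u x"] by (intro mult_left_le_one_le) auto
    moreover have "b / 8 * indicator B x \<le> c (u x) * q"
    proof (cases "x \<in> B")
      case True
      have "ln (1 + x \<bullet> x) \<le> ln (1 + \<rho>\<^sup>2)"
        using normB(1)[OF True] pos[of x] power_mono[of "norm x" \<rho> 2]
        by (simp add: power2_norm_eq_inner)
      then have "g x \<ge> 1 / 2" using N N0 by (simp add: g_def field_simps)
      then have "p \<ge> 1 / 2" by (simp add: p_def)
      then have "p\<^sup>2 \<ge> (1 / 2)\<^sup>2" by (intro power_mono) auto
      moreover have "m \<ge> 1" using normB(2)[OF True] by (simp add: m_def)
      moreover have "b \<le> (norm (X x))\<^sup>2" "c (u x) = 1" using ball[of x] True c(4) by (auto simp: B_def)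
      ultimately have "(1 / 2)\<^sup>2 * 1 * b / 2 \<le> p\<^sup>2 * m * (norm (X x))\<^sup>2 / 2"
        using b by (intro divide_right_mono mult_mono) auto
      then show ?thesis using True \<open>c (u x) = 1\<close> by (simp add: q_def power2_eq_square)
    qed (use c q in simp)
    ultimately show ?thesis by linarith
  qed
  have intB: "integrable lborel (indicator B :: real^'n \<Rightarrow> real)"
    unfolding B_def using borel_integrable_compact[OF compact_cball continuous_on_const, of x0 r "1::real"]
    by simp
  have "(\<integral>x. c (u x) * (X x \<bullet> Z x) \<partial>lborel)
      \<le> (\<integral>x. 8 * t ^ 3 / N\<^sup>2 * S x - b / 8 * indicator B x \<partial>lborel)"
    using flux(1) S(1) intB point by (intro integral_mono) auto
  also have "\<dots> = 8 * t ^ 3 / N\<^sup>2 * integral\<^sup>L lborel S - \<kappa>"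
    using S(1) intB by (simp add: \<kappa>_def B_def)
  also have "8 * t ^ 3 / N\<^sup>2 * integral\<^sup>L lborel S \<le> 8 * t ^ 3 / N\<^sup>2 * (4 * exp 1 * t * N)"
    using S(4) t by (intro mult_left_mono) auto
  also have "\<dots> = 32 * exp 1 * t ^ 4 / N"
    using N0 by (simp add: power2_eq_square power3_eq_cube power4_eq_xxxx)
  also have "\<dots> < \<kappa> / 2" using N(2) N0 \<kappa> by (simp add: field_simps)
  \<comment> \<open>The cost is below \<open>\<kappa> / 2\<close> and the loss is
    \<open>\<kappa>\<close>, whereas the flux inequality allows no value below
    \<open>- \<kappa> / 4\<close>.\<close>
  finally have "(\<integral>x. c (u x) * (X x \<bullet> Z x) \<partial>lborel) < - \<kappa> / 2" by simp
  then show False using flux(2) \<omega>(2) \<kappa> by linarith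
qed

section \<open>From the gradient to the one-dimensional profile\<close>

text \<open>A clopen argument in the connected half-space \<open>H\<close>: the set \<open>T\<close>
  where the affine formula holds in the phase is open, since \<open>u w - w $ k\<close> is locally
  constant, and relatively closed, since the formula passes to limits.\<close>

lemma half_space_of_grad_eq_axis:
  assumes grad: "\<And>x. x \<in> \<Xi> \<Longrightarrow> grad u x = axis k 1" and x0: "x0 \<in> \<Xi>"
    and y: "y $ k > x0 $ k - u x0"
  shows "y \<in> \<Xi> \<and> u y = y $ k - (x0 $ k - u x0)"
proof -
  define a where "a = x0 $ k - u x0"
  define H where "H = {z :: real^'n. z $ k > a}"
  define T where "T = {z \<in> H. z \<in> \<Xi> \<and> u z = z $ k - a}"
  have "connected H" unfolding H_def using convex_halfspace_gt[of a "axis k 1 :: real^'n"]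
    by (intro convex_connected) (simp add: inner_axis')
  have "open H" unfolding H_def using open_halfspace_component_gt_cart by blast
  have "open T"
    unfolding open_contains_ball
  proof
    fix z assume z: "z \<in> T"
    then have "z \<in> H \<inter> \<Xi>" by (auto simp: T_def)
    then obtain e where e: "e > 0" "ball z e \<subseteq> H \<inter> \<Xi>"
      using open_Int[OF \<open>open H\<close> open_phase] open_contains_ball by meson
    have "((\<lambda>w. u w - w $ k) has_derivative (\<lambda>h. 0)) (at w within ball z e)" if "w \<in> ball z e" for w
    proof -
      have "w \<in> \<Xi>" using that e by auto
      have "((\<lambda>w. u w - w $ k) has_derivative (\<lambda>h. axis k 1 \<bullet> h - h $ k)) (at w)"
        using has_derivative_u[OF \<open>w \<in> \<Xi>\<close>] grad[OF \<open>w \<in> \<Xi>\<close>]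
        by (auto intro!: has_derivative_diff bounded_linear.has_derivative[OF bounded_linear_vec_nth])
      then show ?thesis by (simp add: inner_axis' has_derivative_at_withinI)
    qed
    then obtain b where b: "\<And>w. w \<in> ball z e \<Longrightarrow> u w - w $ k = b"
      using has_derivative_zero_constant[OF convex_ball, of z e "\<lambda>w. u w - w $ k"] by blast
    have "b = - a" using b[of z] e z by (auto simp: T_def)
    then have "ball z e \<subseteq> T" using b e by (force simp: T_def)
    then show "\<exists>e>0. ball z e \<subseteq> T" using e by blast
  qed
  moreover have "closedin (top_of_set H) T"
  proof -
    have "closed {z \<in> closure \<Xi>. u z - z $ k = - a}"
      by (intro continuous_closed_preimage_constant continuous_intros continuous_on_closure) auto
    \<comment> \<open>A limit point in \<open>H\<close> cannot leave the phase, because the affine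
      value \<open>z $ k - a\<close> is positive there.\<close>
    moreover have "T = H \<inter> {z \<in> closure \<Xi>. u z - z $ k = - a}"
      using closure_subset[of \<Xi>] by (auto simp: T_def H_def positive_phase_def)
    ultimately show ?thesis by (simp add: closedin_closed_Int)
  qed
  moreover have "x0 \<in> T" using x0 by (auto simp: T_def H_def a_def positive_phase_def)
  moreover have "T \<subseteq> H" by (auto simp: T_def)
  ultimately have "T = H"
    using \<open>connected H\<close> unfolding connected_clopen by (auto intro: open_subset)
  then show ?thesis using y by (auto simp: T_def H_def a_def)
qed

end

theorem theorem15:
  fixes u :: "real^'n \<Rightarrow> real" and k :: 'n
  assumes "CARD('n) \<le> 3"
    and "one_phase_solution u"
    and "positive_phase u \<noteq> {}"
    and "\<forall>x\<in>positive_phase u. norm (grad u x) \<le> 1"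
    and "smooth_hypersurface (frontier (positive_phase u))"
    and "positive_phase u \<subseteq> {x. x $ k > 0}"
  shows "\<exists>h\<ge>0. positive_phase u = {x. x $ k > h} \<and>
           (\<forall>x\<in>closure (positive_phase u). u x = x $ k - h)"
proof -
  interpret one_phase_gradient_bound u using assms by unfold_locales auto
  note half = half_space_of_grad_eq_axis[where k = k, OF grad_eq_axis[OF assms(1,6)], rotated]
  obtain x0 where x0: "x0 \<in> \<Xi>" using assms(3) by blast
  define h where "h = x0 $ k - u x0"
  have up: "y \<in> \<Xi> \<and> u y = y $ k - h" if "y $ k > h" for y
    using half[of x0 y] x0 that by (simp add: h_def)
  have eq: "u x = x $ k - h" if "x \<in> \<Xi>" for x
  proof -
    \<comment> \<open>This point lies above both levels, the one from \<open>x0\<close> and the one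
      from \<open>x\<close>. The two formulas for \<open>u y\<close> force the levels to agree, so
      different components of the phase cannot carry different profiles.\<close>
    define y :: "real^'n" where "y = (\<chi> i. max h (x $ k - u x) + 1)"
    have "u y = y $ k - h" "u y = y $ k - (x $ k - u x)"
      using up[of y] half[of x y] that by (simp_all add: y_def)
    then show ?thesis by simp
  qed
  have "\<Xi> = {x. x $ k > h}"
  proof (intro set_eqI iffI)
    fix x assume "x \<in> \<Xi>"
    then show "x \<in> {x. x $ k > h}" using eq[of x] by (simp add: positive_phase_def)
  qed (use up in blast)
  moreover have "h \<ge> 0"
  proof (rule ccontr)
    assume "\<not> h \<ge> 0"
    \<comment> \<open>A negative level would put the origin into the phase, against the half-space
      hypothesis.\<close>
    then have "(\<chi> i. 0) \<in> \<Xi>" using up[of "\<chi> i. 0"] by simp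
    then show False using assms(6) by auto
  qed
  moreover have "u x = x $ k - h" if "x \<in> closure \<Xi>" for x
  proof -
    have "\<Xi> \<subseteq> {z \<in> closure \<Xi>. u z - z $ k = - h}" using eq closure_subset[of \<Xi>] by auto
    moreover have "closed {z \<in> closure \<Xi>. u z - z $ k = - h}"
      by (intro continuous_closed_preimage_constant continuous_intros continuous_on_closure) auto
    ultimately have "closure \<Xi> \<subseteq> {z \<in> closure \<Xi>. u z - z $ k = - h}" by (rule closure_minimal)
    then show ?thesis using that by auto
  qed
  ultimately show ?thesis by blast
qed

end
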